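(* If $e(i)$ codes the axiom defining the binary function symbol $f_{\underline{i}}^{\underline{2}}$ (that is, the $i$-th axiom exists and defines a function symbol of arity $2$), then given $i$ and any natural number $n$, there is a natural number $m$ such that the algorithm described in the context, run on $(i,n)$, generates a unique proof of $f_{\underline{i}}(\underline{i},\underline{n})=\underline{m}$, at which point the algorithm halts.
   Context: **Language.** PRA-- is a quantifier-free theory. Terms: $0$; $\tau'$ for a term $\tau$; variables; and $f_{\underline{c}}^{\underline{k}}(\tau_1,\dots,\tau_k)$ (a non-numeric term, or nn-term), usually written $f_{\underline{c}}(\tau_1,\dots,\tau_k)$. Each function symbol contains exactly one occurrence of the letter `$f$'. The numeral $\underline{n}$ is $0$ followed by $n$ primes. Formulas are built from equations between terms by $\sim$ and $\supset$; $(\phi\,\&\,\psi)$ abbreviates $\sim(\phi\supset\sim\psi)$. **Indexed axioms for function symbols.** Fix a standard Gödel numbering of strings and sequences of strings, in which the code of a string exceeds the value of every numeral that is a member of the string, and the code of a string of $n+2$ members exceeds $n$. $*$ denotes concatenation. The axioms for function symbols are indexed inductively; an index $c$ of none of the following forms has no axiom. - The $0$th axiom is $f_{\underline 0}(x)=0$. The $1$st axiom is $f_{\underline 1}(x)=x'$. - If $c$ codes $\underline{j}*\underline{k}$ with $1\le j\le k\le c$, the $c$-th axiom is $f_{\underline c}(x_1,\dots,x_k)=x_j$. - (Composition index) If $c$ codes $\underline{0}*\underline{b}*\underline{c_1}*\dots*\underline{c_l}*\underline{k}$ (with $b,c_1,\dots,c_l,k<c$), and the axioms with indices $b,c_1,\dots,c_l$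 define $f_{\underline b}(x_1,\dots,x_l)$, $f_{\underline{c_1}}(x_1,\dots,x_k),\dots,f_{\underline{c_l}}(x_1,\dots,x_k)$, the $c$-th axiom is $f_{\underline c}(x_1,\dots,x_k)=f_{\underline b}(f_{\underline{c_1}}(x_1,\dots,x_k),\dots,f_{\underline{c_l}}(x_1,\dots,x_k))$. - (Recursion index) If $c$ codes $\text{`}\prime\text{'}*\underline{a}*\underline{d}*\underline{k}$ (with $a,d,k<c$), and the $a$-th and $d$-th axioms define $f_{\underline a}(x_1,\dots,x_k)$ and $f_{\underline d}(x_1,\dots,x_{k+2})$, the $c$-th axiom is $f_{\underline c}(x_1,\dots,x_k,0)=f_{\underline a}(x_1,\dots,x_k)\ \&\ f_{\underline c}(x_1,\dots,x_k,y')=f_{\underline d}(f_{\underline c}(x_1,\dots,x_k,y),x_1,\dots,x_k,y)$. $e(i)$ is the code of the $i$-th axiom if there is one, and $0$ otherwise. Composition and recursion indices are called complex; all others are simple. **Other axioms and rules.** Other axioms of PRA--: $\phi\supset(\psi\supset\phi)$; $(\phi\supset(\psi\supset\chi))\supset((\phi\supset\psi)\supset(\phi\supset\chi))$; $(\sim\psi\supset\sim\phi)\supset(\phi\supset\psi)$; $x=x$; $\tau_1=\tau_2\supset(\phi[x/\tau_1]\supset\phi[x/\tau_2])$; $\sim 0=x'$; $x'=y'\supset x=y$; $\sim 0=x\supset(\exists y\le x)\,x=y'$ (bounded quantification being expressed by p.r. function symbols). Rules of PRA--: modus ponens, and (VS) simultaneous substitution of terms for variables. A proof is a finite sequence of formulas,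 each of which is an axiom or follows from earlier members by a rule; in the proofs considered here, besides the rules of PRA--, one may use ($\&$E) conjunction elimination and the following shortcut rules, each of which replaces an occurrence in a formula of a term with numeral arguments by another term: - (Z) $f_{\underline 0}(\underline{m})$ by $\underline 0$. - (S) $f_{\underline 1}(\underline m)$ by $\underline{m}'$. - (P) If $c$ codes $\underline j*\underline k$ with $1\le j\le k\le c$: $f_{\underline c}(\underline{n_1},\dots,\underline{n_k})$ by $\underline{n_j}$. - (C) If $c$ is a composition index, coding $\underline{0}*\underline{b}*\underline{c_1}*\dots*\underline{c_l}*\underline{k}$ where the axioms with indices $b,c_1,\dots,c_l$ define $f_{\underline b}(x_1,\dots,x_l)$, $f_{\underline{c_1}}(x_1,\dots,x_k),\dots,f_{\underline{c_l}}(x_1,\dots,x_k)$: $f_{\underline c}(\underline{n_1},\dots,\underline{n_k})$ by $f_{\underline b}(f_{\underline{c_1}}(\underline{n_1},\dots,\underline{n_k}),\dots,f_{\underline{c_l}}(\underline{n_1},\dots,\underline{n_k}))$. - (R1) If $c$ is a recursion index, coding $\text{`}\prime\text{'}*\underline{a}*\underline{d}*\underline{k}$ where the $a$-th and $d$-th axioms define $f_{\underline a}(x_1,\dots,x_k)$ and $f_{\underline d}(x_1,\dots,x_{k+2})$: $f_{\underline c}(\underline{n_1},\dots,\underline{n_k},\underline 0)$ by $f_{\underline a}(\underline{n_1},\dots,\underline{n_k})$. - (R2) If $c$ is a recursion index, coding $\text{`}\prime\text{'}*\underline{a}*\underline{d}*\underline{k}$ where the $a$-th and $d$-th axioms define $f_{\underline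 a}(x_1,\dots,x_k)$ and $f_{\underline d}(x_1,\dots,x_{k+2})$: $f_{\underline c}(\underline{n_1},\dots,\underline{n_k},\underline{m}')$ by $f_{\underline d}(f_{\underline c}(\underline{n_1},\dots,\underline{n_k},\underline m),\underline{n_1},\dots,\underline{n_k},\underline m)$. **The algorithm** on input $(i,n)$, where the $i$-th axiom defines a binary symbol; it outputs a sequence of formulas (lines). - Step 1. If $i$ codes $\underline{j}*\underline 2$ with $j\in\{1,2\}$: output the axiom for $f_{\underline i}$, then by (VS) the line $f_{\underline i}(\underline i,\underline n)=\underline i$ (if $j=1$) or $f_{\underline i}(\underline i,\underline n)=\underline n$ (if $j=2$), and halt. Otherwise go to Step 2. - Step 2. If $i$ is not a recursion index, go to Step 3. Otherwise $i$ codes $\text{`}\prime\text{'}*\underline a*\underline d*\underline 1$. Write the axiom $f_{\underline i}(x,0)=f_{\underline a}(x)\ \&\ f_{\underline i}(x,y')=f_{\underline d}(f_{\underline i}(x,y),x,y)$. If $n=0$, write its instance under $x/\underline i,\ y/\underline n$ and then, by ($\&$E), $f_{\underline i}(\underline i,0)=f_{\underline a}(\underline i)$. If $n\ne0$, write its instance under $x/\underline i,\ y/\underline{n-1}$ and then, by ($\&$E), $f_{\underline i}(\underline i,\underline{n-1}')=f_{\underline d}(f_{\underline i}(\underline i,\underline{n-1}),\underline i,\underline{n-1})$. Go to Step 4. - Step 3. Write the axiom $f_{\underline i}(x,y)=\phi_i(x,y)$ for $f_{\underline i}$ and then, by (VS), $f_{\underline i}(\underline i,\underline n)=\phi_i(\underline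 i,\underline n)$. Go to Step 4. - Step 4. The right-hand term of the latest line is called the baseline term. Set a counter to the number of occurrences of `$f$' in the baseline term. Go to Step 5. - Step 5. If the counter is $0$, halt. Otherwise (re)start the Main Loop: let $\epsilon$ be the equation on the latest line, and let $\tau$ be the (occurrence of the) nn-term to the right of `$=$' in $\epsilon$ embedded in the most parentheses, choosing the rightmost in case of a tie. Go to Step 6. - Step 6. Let $c$ be the index of $\tau$'s function symbol. Add a new line obtained from $\epsilon$ by replacing $\tau$ via the applicable shortcut rule: (Z) if $c=0$; (S) if $c=1$; (P) if $c$ codes $\underline j*\underline k$ with $1\le j\le k\le c$; (C) if $c$ is a composition index; (R1) if $c$ is a recursion index and the last argument of $\tau$ is $\underline 0$; (R2) if $c$ is a recursion index and the last argument is not $\underline 0$. Change the counter: subtract $1$ for (Z), (S), (P); add $l$ for (C), where $l$ is the number of inner functions; leave unchanged for (R1); add $1$ for (R2). Go back to Step 5. *)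

theory Defs
  imports Main "HOL-Library.Nat_Bijection" "HOL-Library.Countable"
begin

section \<open>The language\<close>

text \<open>The superscript (arity) of a function symbol is the length of its argument list.\<close>

datatype trm =
    Zero
  | Prime trm
  | Var nat
  | App nat "trm list"

datatype form =
    Eq trm trm
  | Neg form
  | Imp form form

definition Conj :: "form \<Rightarrow> form \<Rightarrow> form" where
  "Conj p q = Neg (Imp p (Neg q))"

fun numterm :: "nat \<Rightarrow> trm" where
  "numterm 0 = Zero"
| "numterm (Suc n) = Prime (numterm n)"

fun subst_trm :: "(nat \<Rightarrow> trm) \<Rightarrow> trm \<Rightarrow> trm" where
  "subst_trm s Zero = Zero"
| "subst_trm s (Prime t) = Prime (subst_trm s t)"
| "subst_trm s (Var x) = s x"
| "subst_trm s (App c ts) = App c (map (subst_trm s) ts)"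

fun subst_form :: "(nat \<Rightarrow> trm) \<Rightarrow> form \<Rightarrow> form" where
  "subst_form s (Eq t u) = Eq (subst_trm s t) (subst_trm s u)"
| "subst_form s (Neg p) = Neg (subst_form s p)"
| "subst_form s (Imp p q) = Imp (subst_form s p) (subst_form s q)"

text \<open>The variables $x_1, \dots, x_k$ of the axioms are \<open>Var 1, \<dots>, Var k\<close>; the variable $y$ is
  \<open>Var 0\<close>.\<close>

definition xs :: "nat \<Rightarrow> trm list" where
  "xs k = map Var [1..<Suc k]"

abbreviation yv :: trm where
  "yv \<equiv> Var 0"


section \<open>Strings and Goedel numberings\<close>

datatype sym =
    SZero | SPrime | SF | SVar nat | SLpar | SRpar | SComma | SEq | SNeg | SImp

instance sym :: countable
  by countable_datatype

definition numstr :: "nat \<Rightarrow> sym list" where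
  "numstr n = SZero # replicate n SPrime"

fun commas :: "sym list list \<Rightarrow> sym list" where
  "commas [] = []"
| "commas [s] = s"
| "commas (s # t # ss) = s @ SComma # commas (t # ss)"

fun term_str :: "trm \<Rightarrow> sym list" where
  "term_str Zero = [SZero]"
| "term_str (Prime t) = term_str t @ [SPrime]"
| "term_str (Var x) = [SVar x]"
| "term_str (App c ts) =
     SF # numstr (length ts) @ numstr c @ SLpar # commas (map term_str ts) @ [SRpar]"

fun form_str :: "form \<Rightarrow> sym list" where
  "form_str (Eq t u) = term_str t @ SEq # term_str u"
| "form_str (Neg p) = SNeg # form_str p"
| "form_str (Imp p q) = SLpar # form_str p @ SImp # form_str q @ [SRpar]"

definition goedel_numbering :: "(sym list \<Rightarrow> nat) \<Rightarrow> bool" where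
  "goedel_numbering gn \<longleftrightarrow>
     inj gn \<and>
     (\<forall>u n v. n < gn (u @ numstr n @ v)) \<and>
     (\<forall>s n. length s = n + 2 \<longrightarrow> n < gn s)"

lemma goedel_numbering_exists: "\<exists>gn. goedel_numbering gn"
proof -
  define gn :: "sym list \<Rightarrow> nat" where "gn = (\<lambda>s. list_encode (map to_nat s))"
  have len: "length ns \<le> list_encode ns" for ns :: "nat list"
  proof (induction ns)
    case (Cons n ns)
    then show ?case
      using le_prod_encode_2[of "list_encode ns" n] by simp
  qed simp
  have "length s \<le> gn s" for s
    using len[of "map to_nat s"] by (simp add: gn_def)
  then have bound: "n < length s \<Longrightarrow> n < gn s" for n s
    using less_le_trans by blast
  have "inj gn"
    by (auto simp: gn_def inj_def list_encode_eq inj_map_eq_map)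
  then have "goedel_numbering gn"
    unfolding goedel_numbering_def by (auto intro!: bound simp: numstr_def)
  then show ?thesis by blast
qed


section \<open>The axioms for function symbols\<close>

definition proj_index :: "(sym list \<Rightarrow> nat) \<Rightarrow> nat \<Rightarrow> nat \<Rightarrow> nat \<Rightarrow> bool" where
  "proj_index gn c j k \<longleftrightarrow> c = gn (numstr j @ numstr k) \<and> 1 \<le> j \<and> j \<le> k \<and> k \<le> c"

definition comp_str :: "nat \<Rightarrow> nat list \<Rightarrow> nat \<Rightarrow> sym list" where
  "comp_str b cs k = numstr 0 @ numstr b @ concat (map numstr cs) @ numstr k"

definition rec_str :: "nat \<Rightarrow> nat \<Rightarrow> nat \<Rightarrow> sym list" where
  "rec_str a d k = [SPrime] @ numstr a @ numstr d @ numstr k"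

text \<open>\<open>defines_symbol gn c k\<close>: there is a $c$-th axiom, and it defines a function symbol of arity $k$.\<close>

inductive defines_symbol :: "(sym list \<Rightarrow> nat) \<Rightarrow> nat \<Rightarrow> nat \<Rightarrow> bool" for gn where
  "defines_symbol gn 0 1"
| "defines_symbol gn 1 1"
| "proj_index gn c j k \<Longrightarrow> defines_symbol gn c k"
| "c = gn (comp_str b cs k) \<Longrightarrow> b < c \<Longrightarrow> (\<forall>c' \<in> set cs. c' < c) \<Longrightarrow> k < c \<Longrightarrow>
     defines_symbol gn b (length cs) \<Longrightarrow> (\<forall>c' \<in> set cs. defines_symbol gn c' k) \<Longrightarrow> defines_symbol gn c k"
| "c = gn (rec_str a d k) \<Longrightarrow> a < c \<Longrightarrow> d < c \<Longrightarrow> k < c \<Longrightarrow>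
     defines_symbol gn a k \<Longrightarrow> defines_symbol gn d (k + 2) \<Longrightarrow> defines_symbol gn c (k + 1)"

definition comp_index :: "(sym list \<Rightarrow> nat) \<Rightarrow> nat \<Rightarrow> nat \<Rightarrow> nat list \<Rightarrow> nat \<Rightarrow> bool" where
  "comp_index gn c b cs k \<longleftrightarrow>
     c = gn (comp_str b cs k) \<and> b < c \<and> (\<forall>c' \<in> set cs. c' < c) \<and> k < c \<and>
     defines_symbol gn b (length cs) \<and> (\<forall>c' \<in> set cs. defines_symbol gn c' k)"

definition rec_index :: "(sym list \<Rightarrow> nat) \<Rightarrow> nat \<Rightarrow> nat \<Rightarrow> nat \<Rightarrow> nat \<Rightarrow> bool" where
  "rec_index gn c a d k \<longleftrightarrow>
     c = gn (rec_str a d k) \<and> a < c \<and> d < c \<and> k < c \<and>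
     defines_symbol gn a k \<and> defines_symbol gn d (k + 2)"

text \<open>\<open>fun_axiom gn c k A\<close>: the $c$-th axiom is $A$, and it defines a function symbol of arity $k$.\<close>

inductive fun_axiom :: "(sym list \<Rightarrow> nat) \<Rightarrow> nat \<Rightarrow> nat \<Rightarrow> form \<Rightarrow> bool" for gn where
  "fun_axiom gn 0 1 (Eq (App 0 [Var 1]) Zero)"
| "fun_axiom gn 1 1 (Eq (App 1 [Var 1]) (Prime (Var 1)))"
| "proj_index gn c j k \<Longrightarrow> fun_axiom gn c k (Eq (App c (xs k)) (Var j))"
| "comp_index gn c b cs k \<Longrightarrow>
     fun_axiom gn c k (Eq (App c (xs k)) (App b (map (\<lambda>c'. App c' (xs k)) cs)))"
| "rec_index gn c a d k \<Longrightarrow>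
     fun_axiom gn c (k + 1)
       (Conj (Eq (App c (xs k @ [Zero])) (App a (xs k)))
             (Eq (App c (xs k @ [Prime yv])) (App d (App c (xs k @ [yv]) # xs k @ [yv]))))"

definition e :: "(sym list \<Rightarrow> nat) \<Rightarrow> nat \<Rightarrow> nat" where
  "e gn i = (if \<exists>k A. fun_axiom gn i k A
             then gn (form_str (THE A. \<exists>k. fun_axiom gn i k A)) else 0)"


section \<open>Bounded quantification\<close>

text \<open>Indices for the primitive recursive functions that express bounded existential
  quantification. A relation is represented by a function with value $0$ exactly where the
  relation holds, so $(\exists y \le z)$ becomes a product over $y \le z$.\<close>

definition P_ix :: "(sym list \<Rightarrow> nat) \<Rightarrow> nat \<Rightarrow> nat \<Rightarrow> nat" where
  "P_ix gn j k = gn (numstr j @ numstr k)"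

definition C_ix :: "(sym list \<Rightarrow> nat) \<Rightarrow> nat \<Rightarrow> nat list \<Rightarrow> nat \<Rightarrow> nat" where
  "C_ix gn b cs k = gn (comp_str b cs k)"

definition R_ix :: "(sym list \<Rightarrow> nat) \<Rightarrow> nat \<Rightarrow> nat \<Rightarrow> nat \<Rightarrow> nat" where
  "R_ix gn a d k = gn (rec_str a d k)"

definition add_ix :: "(sym list \<Rightarrow> nat) \<Rightarrow> nat" where
  "add_ix gn = R_ix gn (P_ix gn 1 1) (C_ix gn 1 [P_ix gn 1 3] 3) 1"

definition mult_ix :: "(sym list \<Rightarrow> nat) \<Rightarrow> nat" where
  "mult_ix gn = R_ix gn 0 (C_ix gn (add_ix gn) [P_ix gn 1 3, P_ix gn 2 3] 3) 1"

text \<open>There are no symbols of arity 0, so the predecessor is obtained from a binary function.\<close>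

definition pred_ix :: "(sym list \<Rightarrow> nat) \<Rightarrow> nat" where
  "pred_ix gn = C_ix gn (R_ix gn 0 (P_ix gn 3 3) 1) [P_ix gn 1 1, P_ix gn 1 1] 1"

definition monus_ix :: "(sym list \<Rightarrow> nat) \<Rightarrow> nat" where
  "monus_ix gn = R_ix gn (P_ix gn 1 1) (C_ix gn (pred_ix gn) [P_ix gn 1 3] 3) 1"

definition dist_ix :: "(sym list \<Rightarrow> nat) \<Rightarrow> nat" where
  "dist_ix gn =
     C_ix gn (add_ix gn) [monus_ix gn, C_ix gn (monus_ix gn) [P_ix gn 2 2, P_ix gn 1 2] 2] 2"

text \<open>The relation $x = y'$ in $(x, y)$.\<close>

definition eq_prime_ix :: "(sym list \<Rightarrow> nat) \<Rightarrow> nat" where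
  "eq_prime_ix gn = C_ix gn (dist_ix gn) [P_ix gn 1 2, C_ix gn 1 [P_ix gn 2 2] 2] 2"

text \<open>For the index \<open>r\<close> of a binary relation $R(x, y)$: the relation $(\exists y \le z)\, R(x, y)$
  in $(x, z)$.\<close>

definition bex_ix :: "(sym list \<Rightarrow> nat) \<Rightarrow> nat \<Rightarrow> nat" where
  "bex_ix gn r =
     R_ix gn (C_ix gn r [P_ix gn 1 1, 0] 1)
       (C_ix gn (mult_ix gn)
          [P_ix gn 1 3, C_ix gn r [P_ix gn 2 3, C_ix gn 1 [P_ix gn 3 3] 3] 3] 3) 1"


section \<open>Axioms, rules and proofs\<close>

inductive pra_axiom :: "(sym list \<Rightarrow> nat) \<Rightarrow> form \<Rightarrow> bool" for gn where
  "fun_axiom gn c k A \<Longrightarrow> pra_axiom gn A"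
| "pra_axiom gn (Imp p (Imp q p))"
| "pra_axiom gn (Imp (Imp p (Imp q r)) (Imp (Imp p q) (Imp p r)))"
| "pra_axiom gn (Imp (Imp (Neg q) (Neg p)) (Imp p q))"
| "pra_axiom gn (Eq (Var x) (Var x))"
| "pra_axiom gn (Imp (Eq t u) (Imp (subst_form (Var(x := t)) p) (subst_form (Var(x := u)) p)))"
| "pra_axiom gn (Neg (Eq Zero (Prime (Var x))))"
| "pra_axiom gn (Imp (Eq (Prime (Var x)) (Prime (Var y))) (Eq (Var x) (Var y)))"
| "pra_axiom gn (Imp (Neg (Eq Zero (Var x)))
                     (Eq (App (bex_ix gn (eq_prime_ix gn)) [Var x, Var x]) Zero))"

text \<open>The argument of \<open>RuleC\<close> is the number of inner functions.\<close>

datatype rule = RuleZ | RuleS | RuleP | RuleC nat | RuleR1 | RuleR2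

inductive shortcut :: "(sym list \<Rightarrow> nat) \<Rightarrow> rule \<Rightarrow> trm \<Rightarrow> trm \<Rightarrow> bool" for gn where
  "shortcut gn RuleZ (App 0 [numterm m]) Zero"
| "shortcut gn RuleS (App 1 [numterm m]) (Prime (numterm m))"
| "proj_index gn c j k \<Longrightarrow> length ns = k \<Longrightarrow>
     shortcut gn RuleP (App c (map numterm ns)) (numterm (ns ! (j - 1)))"
| "comp_index gn c b cs k \<Longrightarrow> length ns = k \<Longrightarrow>
     shortcut gn (RuleC (length cs)) (App c (map numterm ns))
       (App b (map (\<lambda>c'. App c' (map numterm ns)) cs))"
| "rec_index gn c a d k \<Longrightarrow> length ns = k \<Longrightarrow>
     shortcut gn RuleR1 (App c (map numterm ns @ [Zero])) (App a (map numterm ns))"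
| "rec_index gn c a d k \<Longrightarrow> length ns = k \<Longrightarrow>
     shortcut gn RuleR2 (App c (map numterm ns @ [Prime (numterm m)]))
       (App d (App c (map numterm ns @ [numterm m]) # map numterm ns @ [numterm m]))"

text \<open>Occurrences of subterms are given by paths in the syntax tree.\<close>

fun subterm_at :: "trm \<Rightarrow> nat list \<Rightarrow> trm option" where
  "subterm_at t [] = Some t"
| "subterm_at (Prime t) (j # p) = (if j = 0 then subterm_at t p else None)"
| "subterm_at (App c ts) (j # p) = (if j < length ts then subterm_at (ts ! j) p else None)"
| "subterm_at t (j # p) = None"

fun replace_at :: "trm \<Rightarrow> nat list \<Rightarrow> trm \<Rightarrow> trm" where
  "replace_at t [] u = u"
| "replace_at (Prime t) (j # p) u = Prime (replace_at t p u)"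
| "replace_at (App c ts) (j # p) u = App c (ts[j := replace_at (ts ! j) p u])"
| "replace_at t (j # p) u = t"

inductive shortcut_form :: "(sym list \<Rightarrow> nat) \<Rightarrow> form \<Rightarrow> form \<Rightarrow> bool" for gn where
  "subterm_at t p = Some v \<Longrightarrow> shortcut gn r v w \<Longrightarrow>
     shortcut_form gn (Eq t u) (Eq (replace_at t p w) u)"
| "subterm_at u p = Some v \<Longrightarrow> shortcut gn r v w \<Longrightarrow>
     shortcut_form gn (Eq t u) (Eq t (replace_at u p w))"
| "shortcut_form gn p p' \<Longrightarrow> shortcut_form gn (Neg p) (Neg p')"
| "shortcut_form gn p p' \<Longrightarrow> shortcut_form gn (Imp p q) (Imp p' q)"
| "shortcut_form gn q q' \<Longrightarrow> shortcut_form gn (Imp p q) (Imp p q')"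

text \<open>\<open>follows gn F q\<close>: the formula \<open>q\<close> follows from members of \<open>F\<close> by one rule. The rules are
  modus ponens, (VS), the two forms of (\&E), and the shortcut rules.\<close>

inductive follows :: "(sym list \<Rightarrow> nat) \<Rightarrow> form set \<Rightarrow> form \<Rightarrow> bool" for gn F where
  "p \<in> F \<Longrightarrow> Imp p q \<in> F \<Longrightarrow> follows gn F q"
| "p \<in> F \<Longrightarrow> follows gn F (subst_form s p)"
| "Conj p q \<in> F \<Longrightarrow> follows gn F p"
| "Conj p q \<in> F \<Longrightarrow> follows gn F q"
| "p \<in> F \<Longrightarrow> shortcut_form gn p q \<Longrightarrow> follows gn F q"

definition is_proof :: "(sym list \<Rightarrow> nat) \<Rightarrow> form list \<Rightarrow> bool" where
  "is_proof gn L \<longleftrightarrow>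
     (\<forall>j < length L. pra_axiom gn (L ! j) \<or> follows gn (set (take j L)) (L ! j))"

definition proof_of :: "(sym list \<Rightarrow> nat) \<Rightarrow> form list \<Rightarrow> form \<Rightarrow> bool" where
  "proof_of gn L q \<longleftrightarrow> is_proof gn L \<and> L \<noteq> [] \<and> last L = q"


section \<open>The algorithm\<close>

text \<open>The number of pairs of parentheses in which an occurrence is embedded.\<close>

fun paren_depth :: "trm \<Rightarrow> nat list \<Rightarrow> nat" where
  "paren_depth (App c ts) (j # p) = Suc (paren_depth (ts ! j) p)"
| "paren_depth (Prime t) (j # p) = paren_depth t p"
| "paren_depth t p = 0"

definition nn_occurrence :: "trm \<Rightarrow> nat list \<Rightarrow> bool" where
  "nn_occurrence t p \<longleftrightarrow> (\<exists>c ts. subterm_at t p = Some (App c ts))"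

text \<open>Occurrences embedded in equally many parentheses are not nested in one another, so the
  lexicographic order of their paths is their order from left to right.\<close>

definition selected :: "trm \<Rightarrow> nat list \<Rightarrow> bool" where
  "selected t p \<longleftrightarrow> nn_occurrence t p \<and>
     (\<forall>q. nn_occurrence t q \<and> q \<noteq> p \<longrightarrow>
        paren_depth t q < paren_depth t p \<or>
        paren_depth t q = paren_depth t p \<and> (q, p) \<in> lexord {(a, b). a < b})"

fun adjust :: "rule \<Rightarrow> nat \<Rightarrow> nat" where
  "adjust RuleZ k = k - 1"
| "adjust RuleS k = k - 1"
| "adjust RuleP k = k - 1"
| "adjust (RuleC l) k = k + l"
| "adjust RuleR1 k = k"
| "adjust RuleR2 k = k + 1"

text \<open>A configuration consists of the step to be performed next, the lines written so far, the
  counter (from Step 5 on), and the occurrence picked in Step 5 (for Step 6). Nothing has been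
  written on entering Steps 1 to 3.\<close>

datatype config =
    Step1
  | Step2
  | Step3
  | Step4 "form list"
  | Step5 "form list" nat
  | Step6 "form list" nat "nat list"
  | Halted "form list"

inductive step :: "(sym list \<Rightarrow> nat) \<Rightarrow> nat \<Rightarrow> nat \<Rightarrow> config \<Rightarrow> config \<Rightarrow> bool" for gn i n where
  step1_fst: "i = gn (numstr 1 @ numstr 2) \<Longrightarrow> fun_axiom gn i 2 A \<Longrightarrow>
     step gn i n Step1 (Halted [A, Eq (App i [numterm i, numterm n]) (numterm i)])"
| step1_snd: "i = gn (numstr 2 @ numstr 2) \<Longrightarrow> fun_axiom gn i 2 A \<Longrightarrow>
     step gn i n Step1 (Halted [A, Eq (App i [numterm i, numterm n]) (numterm n)])"
| step1_else: "i \<noteq> gn (numstr 1 @ numstr 2) \<Longrightarrow> i \<noteq> gn (numstr 2 @ numstr 2) \<Longrightarrow>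
     step gn i n Step1 Step2"
| step2_else: "(\<nexists>a d k. rec_index gn i a d k) \<Longrightarrow> step gn i n Step2 Step3"
| step2_zero: "rec_index gn i a d 1 \<Longrightarrow> fun_axiom gn i 2 A \<Longrightarrow> n = 0 \<Longrightarrow>
     step gn i n Step2
       (Step4 [A,
               subst_form (Var(1 := numterm i, 0 := numterm n)) A,
               Eq (App i [numterm i, Zero]) (App a [numterm i])])"
| step2_prime: "rec_index gn i a d 1 \<Longrightarrow> fun_axiom gn i 2 A \<Longrightarrow> n \<noteq> 0 \<Longrightarrow>
     step gn i n Step2
       (Step4 [A,
               subst_form (Var(1 := numterm i, 0 := numterm (n - 1))) A,
               Eq (App i [numterm i, Prime (numterm (n - 1))])
                  (App d [App i [numterm i, numterm (n - 1)], numterm i, numterm (n - 1)])])"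
| step3: "fun_axiom gn i 2 A \<Longrightarrow> A = Eq (App i [Var 1, Var 2]) t \<Longrightarrow>
     step gn i n Step3 (Step4 [A, subst_form (Var(1 := numterm i, 2 := numterm n)) A])"
| step4: "last L = Eq s t \<Longrightarrow>
     step gn i n (Step4 L) (Step5 L (count_list (term_str t) SF))"
| step5_halt: "step gn i n (Step5 L 0) (Halted L)"
| step5_loop: "k \<noteq> 0 \<Longrightarrow> last L = Eq s t \<Longrightarrow> selected t p \<Longrightarrow>
     step gn i n (Step5 L k) (Step6 L k p)"
| step6: "last L = Eq s t \<Longrightarrow> subterm_at t p = Some v \<Longrightarrow> shortcut gn r v w \<Longrightarrow>
     step gn i n (Step6 L k p) (Step5 (L @ [Eq s (replace_at t p w)]) (adjust r k))"

definition generates :: "(sym list \<Rightarrow> nat) \<Rightarrow> nat \<Rightarrow> nat \<Rightarrow> form list \<Rightarrow> bool" where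
  "generates gn i n L \<longleftrightarrow> (step gn i n)\<^sup>*\<^sup>* Step1 (Halted L)"

text \<open>The algorithm is a relation, so halting means that no run is infinite and that no run gets
  stuck in a configuration other than a halted one.\<close>

definition halts :: "(sym list \<Rightarrow> nat) \<Rightarrow> nat \<Rightarrow> nat \<Rightarrow> bool" where
  "halts gn i n \<longleftrightarrow>
     (\<nexists>g. g 0 = Step1 \<and> (\<forall>j. step gn i n (g j) (g (Suc j)))) \<and>
     (\<forall>c. (step gn i n)\<^sup>*\<^sup>* Step1 c \<and> (\<nexists>c'. step gn i n c c') \<longrightarrow> (\<exists>L. c = Halted L))"

end

theory Submission
  imports Defs
begin

text \<open>
  The algorithm is deterministic, and it is an innermost rewriting strategy for a system in which
  every strategy takes the same number of steps: a shortcut needs numerals as arguments, so it can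
  neither duplicate nor discard an occurrence of another function symbol.

  Determinism comes from the injectivity of the Goedel numbering: an index can be decoded in only
  one way (\<open>fun_axiom_unique\<close>), hence at most one shortcut applies to a given term
  (\<open>shortcut_unique\<close>), and the deepest rightmost occurrence is unique
  (\<open>selected_unique\<close>). For a deterministic relation one run that ends is all the runs there
  are, so uniqueness and halting both follow once a single run to a halted configuration is
  exhibited.

  For such a run, \<open>evaluates gn t m k\<close> says that the closed term \<open>t\<close> has value \<open>m\<close>
  and that \<open>k\<close> shortcuts reduce it to the numeral of \<open>m\<close>. Every primitive recursive symbol
  applied to numerals has a value in this sense: this is an induction on the definition of the
  symbol, and on the last argument for a recursion (\<open>symbol_evaluates\<close>). The cost \<open>k\<close> is
  additive over arguments, so a shortcut applied to any occurrence whatever preserves the value and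
  lowers the cost by exactly one (\<open>evaluates_replace\<close>). Thus the cost bounds the main loop.

  Three further points make the loop do what it should. The counter always equals the number of
  occurrences of the letter f in the current right-hand term (\<open>adjust_correct\<close>), so it
  vanishes exactly when that term is a numeral. As long as it does not vanish, some occurrence is
  selected (\<open>selected_exists\<close>). The arguments of the selected occurrence contain no function
  symbol, because such a symbol would lie deeper; they are therefore numerals, and a shortcut
  applies (\<open>selected_shortcut\<close>).
\<close>

section \<open>Decoding indices\<close>

text \<open>A numeral at the front of a string can be read off when what comes next cannot be mistaken for
  further primes.\<close>

lemma numstr_append_eqD:
  assumes "numstr m @ u = numstr n @ v"
    and "u = [] \<or> hd u = SZero" "v = [] \<or> hd v = SZero"
  shows "m = n \<and> u = v"
proof -
  have parse: "takeWhile ((=) SPrime) (replicate l SPrime @ w) = replicate l SPrime"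
    if "w = [] \<or> hd w = SZero" for l and w :: "sym list"
    using that by (induction l; cases w) auto
  have eq: "replicate m SPrime @ u = replicate n SPrime @ v"
    using assms(1) by (simp add: numstr_def)
  then have "replicate m SPrime = replicate n SPrime"
    using parse[OF assms(2), of m] parse[OF assms(3), of n] by simp
  then have "m = n" by simp
  with eq show ?thesis by simp
qed

lemma concat_numstr_inj:
  "concat (map numstr ms) = concat (map numstr ns) \<Longrightarrow> ms = ns"
proof (induction ms arbitrary: ns)
  case Nil
  then show ?case by (cases ns) (auto simp: numstr_def)
next
  case (Cons m ms)
  have start: "concat (map numstr ks) = [] \<or> hd (concat (map numstr ks)) = SZero" for ks
    by (cases ks) (auto simp: numstr_def)
  from Cons.prems obtain n ns' where "ns = n # ns'"
    by (cases ns) (auto simp: numstr_def)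
  then show ?case
    using Cons numstr_append_eqD[OF _ start start, of m ms n ns'] by auto
qed

lemma proj_str_eq_concat: "numstr j @ numstr k = concat (map numstr [j, k])"
  by simp

lemma comp_str_eq_concat: "comp_str b cs k = concat (map numstr (0 # b # cs @ [k]))"
  by (simp add: comp_str_def)

lemma rec_str_eq_concat: "rec_str a d k = SPrime # concat (map numstr [a, d, k])"
  by (simp add: rec_str_def)

text \<open>This tells recursion indices apart: their strings alone do not begin with a numeral. The other
  strings, written as sequences of numerals above, are told apart by \<open>concat_numstr_inj\<close>.\<close>

lemma concat_numstr_neq_SPrime: "concat (map numstr ns) \<noteq> SPrime # u"
  by (cases ns) (auto simp: numstr_def)

lemma gn_eqD: "goedel_numbering gn \<Longrightarrow> gn s = gn t \<Longrightarrow> s = t"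
  by (auto simp: goedel_numbering_def inj_def)

text \<open>The indices \<open>0\<close> and \<open>1\<close> are reserved for zero and successor. A projection index exceeds
  the numeral \<open>j \<ge> 1\<close> in its string, and the strings of the complex indices have at least three
  members, so none of them collides with these two.\<close>

lemma proj_index_gt1: "goedel_numbering gn \<Longrightarrow> proj_index gn c j k \<Longrightarrow> 1 < c"
  unfolding goedel_numbering_def proj_index_def
  by (metis append_Nil le_less_trans)

lemma gn_gt1:
  assumes "goedel_numbering gn" "3 \<le> length s"
  shows "1 < gn s"
proof -
  have "length s = (length s - 2) + 2" using assms(2) by simp
  then have "length s - 2 < gn s"
    using assms(1) unfolding goedel_numbering_def by blast
  then show ?thesis using assms(2) by simp
qed

lemma comp_index_gt1: "goedel_numbering gn \<Longrightarrow> comp_index gn c b cs k \<Longrightarrow> 1 < c"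
  by (auto simp: comp_index_def comp_str_def numstr_def simp del: One_nat_def intro!: gn_gt1)

lemma rec_index_gt1: "goedel_numbering gn \<Longrightarrow> rec_index gn c a d k \<Longrightarrow> 1 < c"
  by (auto simp: rec_index_def rec_str_def numstr_def simp del: One_nat_def intro!: gn_gt1)

lemma proj_index_unique:
  assumes "goedel_numbering gn" "proj_index gn c j k" "proj_index gn c j' k'"
  shows "j = j' \<and> k = k'"
  using assms concat_numstr_inj[of "[j, k]" "[j', k']"]
  by (auto simp: proj_index_def dest!: gn_eqD)

lemma comp_index_unique:
  assumes "goedel_numbering gn" "comp_index gn c b cs k" "comp_index gn c b' cs' k'"
  shows "b = b' \<and> cs = cs' \<and> k = k'"
proof -
  have "comp_str b cs k = comp_str b' cs' k'"
    using assms by (auto simp: comp_index_def dest!: gn_eqD)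
  then have "0 # b # cs @ [k] = 0 # b' # cs' @ [k']"
    unfolding comp_str_eq_concat by (rule concat_numstr_inj)
  then show ?thesis by simp
qed

lemma rec_index_unique:
  assumes "goedel_numbering gn" "rec_index gn c a d k" "rec_index gn c a' d' k'"
  shows "a = a' \<and> d = d' \<and> k = k'"
proof -
  have "rec_str a d k = rec_str a' d' k'"
    using assms by (auto simp: rec_index_def dest!: gn_eqD)
  then have "concat (map numstr [a, d, k]) = concat (map numstr [a', d', k'])"
    unfolding rec_str_eq_concat by simp
  from concat_numstr_inj[OF this] show ?thesis by simp
qed

text \<open>Both kinds of string are sequences of numerals, but the first numeral is \<open>j \<ge> 1\<close> for a
  projection and \<open>0\<close> for a composition.\<close>

lemma proj_comp_disjoint:
  assumes "goedel_numbering gn" "proj_index gn c j k"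
  shows "\<not> comp_index gn c b cs k'"
proof
  assume "comp_index gn c b cs k'"
  then have "numstr j @ numstr k = comp_str b cs k'"
    using assms by (auto simp: proj_index_def comp_index_def dest!: gn_eqD)
  then show False
    unfolding comp_str_eq_concat proj_str_eq_concat using concat_numstr_inj by fastforce
qed

lemma proj_rec_disjoint:
  assumes "goedel_numbering gn" "proj_index gn c j k"
  shows "\<not> rec_index gn c a d k'"
proof
  assume "rec_index gn c a d k'"
  then have "numstr j @ numstr k = rec_str a d k'"
    using assms by (auto simp: proj_index_def rec_index_def dest!: gn_eqD)
  then show False
    unfolding rec_str_eq_concat proj_str_eq_concat using concat_numstr_neq_SPrime by blast
qed

lemma comp_rec_disjoint:
  assumes "goedel_numbering gn" "comp_index gn c b cs k"
  shows "\<not> rec_index gn c a d k'"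
proof
  assume "rec_index gn c a d k'"
  then have "comp_str b cs k = rec_str a d k'"
    using assms by (auto simp: comp_index_def rec_index_def dest!: gn_eqD)
  then show False
    unfolding rec_str_eq_concat comp_str_eq_concat using concat_numstr_neq_SPrime by blast
qed

lemmas index_disjoint = proj_comp_disjoint proj_rec_disjoint comp_rec_disjoint
lemmas index_gt1 = proj_index_gt1 comp_index_gt1 rec_index_gt1

lemma fun_axiom_unique:
  assumes "goedel_numbering gn" "fun_axiom gn c k A" "fun_axiom gn c k' A'"
  shows "A = A'"
  using assms(2)
proof cases
  case 1
  from assms(3) show ?thesis
    by cases (use 1 in \<open>auto dest: index_gt1[OF assms(1)]\<close>)
next
  case 2
  from assms(3) show ?thesis
    by cases (use 2 in \<open>auto dest: index_gt1[OF assms(1)]\<close>)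
next
  case (3 j)
  from assms(3) show ?thesis
    by cases (use 3 in \<open>auto dest: index_gt1[OF assms(1)]
      proj_index_unique[OF assms(1)] index_disjoint[OF assms(1)]\<close>)
next
  case (4 b cs)
  from assms(3) show ?thesis
    by cases (use 4 in \<open>auto dest: index_gt1[OF assms(1)]
      comp_index_unique[OF assms(1)] index_disjoint[OF assms(1)]\<close>)
next
  case (5 a d k)
  from assms(3) show ?thesis
    by cases (use 5 in \<open>auto dest: index_gt1[OF assms(1)]
      rec_index_unique[OF assms(1)] index_disjoint[OF assms(1)]\<close>)
qed

lemma fun_axiom_defines_symbol: "fun_axiom gn c k A \<Longrightarrow> defines_symbol gn c k"
  by (cases rule: fun_axiom.cases)
     (auto simp: comp_index_def rec_index_def
           intro: defines_symbol.intros(1)[simplified] defines_symbol.intros(2)[simplified]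
                  defines_symbol.intros(3) defines_symbol.intros(4)
                  defines_symbol.intros(5)[simplified])


section \<open>Determinism\<close>

lemma numterm_inject [simp]: "numterm m = numterm n \<longleftrightarrow> m = n"
proof (induction m arbitrary: n)
  case 0
  then show ?case by (cases n) auto
next
  case (Suc m)
  then show ?case by (cases n) auto
qed

lemma map_numterm_inject [simp]: "map numterm ms = map numterm ns \<longleftrightarrow> ms = ns"
  by (rule inj_map_eq_map) (simp add: inj_def)

lemma shortcut_unique:
  assumes "goedel_numbering gn" "shortcut gn r v w" "shortcut gn r' v w'"
  shows "r = r' \<and> w = w'"
  using assms(2)
proof cases
  case (1 m)
  from assms(3) show ?thesis
    by cases (use 1 in \<open>auto dest: index_gt1[OF assms(1)]\<close>)
next
  case (2 m)
  from assms(3) show ?thesis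
    by cases (use 2 in \<open>auto dest: index_gt1[OF assms(1)]\<close>)
next
  case (3 c j k ns)
  from assms(3) show ?thesis
    by cases (use 3 in \<open>auto dest: index_gt1[OF assms(1)]
      proj_index_unique[OF assms(1)] index_disjoint[OF assms(1)]\<close>)
next
  case (4 c b cs k ns)
  from assms(3) show ?thesis
    by cases (use 4 in \<open>auto dest: index_gt1[OF assms(1)]
      comp_index_unique[OF assms(1)] index_disjoint[OF assms(1)]\<close>)
next
  case (5 c a d k ns)
  from assms(3) show ?thesis
    by cases (use 5 in \<open>auto dest: index_gt1[OF assms(1)]
      rec_index_unique[OF assms(1)] index_disjoint[OF assms(1)]\<close>)
next
  case (6 c a d k ns m)
  from assms(3) show ?thesis
    by cases (use 6 in \<open>auto dest: index_gt1[OF assms(1)]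
      rec_index_unique[OF assms(1)] index_disjoint[OF assms(1)]\<close>)
qed

text \<open>Depth followed by the lexicographic order of paths is a strict order, so it has at most one
  greatest occurrence.\<close>

lemma selected_unique:
  assumes "selected t p" "selected t q"
  shows "p = q"
proof (rule ccontr)
  assume "p \<noteq> q"
  with assms have "(q, p) \<in> lexord {(a, b). a < b}" "(p, q) \<in> lexord {(a, b). a < b}"
    unfolding selected_def by (metis less_asym less_irrefl)+
  moreover have "asym {(a, b). a < (b :: nat)}"
    by (auto intro: asymI)
  ultimately show False
    by (meson asymD lexord_asym)
qed

lemma step_deterministic:
  assumes "goedel_numbering gn" "step gn i n c c1" "step gn i n c c2"
  shows "c1 = c2"
proof -
  have codes: "gn (numstr 1 @ numstr 2) \<noteq> gn (numstr 2 @ numstr 2)"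
    using gn_eqD[OF assms(1)] by (fastforce simp: numstr_def numeral_2_eq_2)
  from assms(2) show ?thesis
  proof cases
    case (step1_fst A)
    from assms(3) show ?thesis
      by cases (use step1_fst codes in \<open>auto dest: fun_axiom_unique[OF assms(1)]\<close>)
  next
    case (step1_snd A)
    from assms(3) show ?thesis
      by cases (use step1_snd codes in \<open>auto dest: fun_axiom_unique[OF assms(1)]\<close>)
  next
    case step1_else
    from assms(3) show ?thesis
      by cases (use step1_else in auto)
  next
    case step2_else
    from assms(3) show ?thesis
      by cases (use step2_else in auto)
  next
    case (step2_zero a d A)
    from assms(3) show ?thesis
      by cases (use step2_zero in \<open>auto dest: fun_axiom_unique[OF assms(1)]
        rec_index_unique[OF assms(1)]\<close>)
  next
    case (step2_prime a d A)
    from assms(3) show ?thesis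
      by cases (use step2_prime in \<open>auto dest: fun_axiom_unique[OF assms(1)]
        rec_index_unique[OF assms(1)]\<close>)
  next
    case (step3 A t)
    from assms(3) show ?thesis
      by cases (use step3 in \<open>auto dest: fun_axiom_unique[OF assms(1)]\<close>)
  next
    case (step4 L s t)
    from assms(3) show ?thesis
      by cases (use step4 in auto)
  next
    case (step5_halt L)
    from assms(3) show ?thesis
      by cases (use step5_halt in auto)
  next
    case (step5_loop k L s t p)
    from assms(3) show ?thesis
      by cases (use step5_loop in \<open>auto dest: selected_unique\<close>)
  next
    case (step6 L s t p v r w k)
    from assms(3) show ?thesis
      unfolding step6(1)
      by cases (use step6 shortcut_unique[OF assms(1)] in fastforce)
  qed
qed

text \<open>The two facts that turn one terminating run into a statement about all runs: every reachable
  configuration lies on that run, and an infinite run would have to follow it past its end.\<close>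

lemma deterministic_reaches_end:
  assumes det: "right_unique R"
    and "R\<^sup>*\<^sup>* a b" "\<And>y. \<not> R b y" "R\<^sup>*\<^sup>* a c"
  shows "R\<^sup>*\<^sup>* c b"
  using assms(2,4)
proof (induction rule: converse_rtranclp_induct)
  case base
  then show ?case using assms(3) by (metis converse_rtranclpE rtranclp.rtrancl_refl)
next
  case (step x y)
  from step.prems show ?case
  proof (cases rule: converse_rtranclpE)
    case base
    then show ?thesis using step.hyps by (meson converse_rtranclp_into_rtranclp)
  next
    case (step z)
    then show ?thesis using right_uniqueD[OF det] step.IH step.hyps by metis
  qed
qed

lemma deterministic_no_infinite_run:
  assumes det: "right_unique R"
    and "R\<^sup>*\<^sup>* a b" "\<And>y. \<not> R b y"
  shows "\<not> (g 0 = a \<and> (\<forall>j. R (g j) (g (Suc j))))"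
  using assms(2)
proof (induction arbitrary: g rule: converse_rtranclp_induct)
  case base
  then show ?case using assms(3) by metis
next
  case (step x y)
  show ?case
  proof
    assume run: "g 0 = x \<and> (\<forall>j. R (g j) (g (Suc j)))"
    then have "g 1 = y" using right_uniqueD[OF det] step.hyps(1) by (metis One_nat_def)
    then show False using run step.IH[of "\<lambda>j. g (Suc j)"] by simp
  qed
qed


section \<open>Evaluation of closed terms\<close>

text \<open>The value and the cost of a closed term. The rule for applications takes the contractum from the
  shortcut relation itself, so one rule covers all six shortcuts and the arguments are always
  evaluated first, as in an innermost strategy. The \<open>Suc\<close> in the cost counts the shortcut.\<close>

inductive evaluates :: "(sym list \<Rightarrow> nat) \<Rightarrow> trm \<Rightarrow> nat \<Rightarrow> nat \<Rightarrow> bool" for gn where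
  evaluates_Zero: "evaluates gn Zero 0 0"
| evaluates_Prime: "evaluates gn t m k \<Longrightarrow> evaluates gn (Prime t) (Suc m) k"
| evaluates_App: "length ms = length ts \<Longrightarrow> length ks = length ts \<Longrightarrow>
     (\<forall>j < length ts. evaluates gn (ts ! j) (ms ! j) (ks ! j)) \<Longrightarrow>
     shortcut gn r (App c (map numterm ms)) w \<Longrightarrow> evaluates gn w m k \<Longrightarrow>
     evaluates gn (App c ts) m (Suc (sum_list ks + k))"

inductive_cases evaluates_ZeroE: "evaluates gn Zero m k"
inductive_cases evaluates_PrimeE: "evaluates gn (Prime t) m k"

lemma evaluates_AppE:
  assumes "evaluates gn (App c ts) m k"
  obtains (App) ms ks r w l where "k = Suc (sum_list ks + l)"
    "length ms = length ts" "length ks = length ts"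
    "\<forall>j < length ts. evaluates gn (ts ! j) (ms ! j) (ks ! j)"
    "shortcut gn r (App c (map numterm ms)) w" "evaluates gn w m l"
  using assms by cases auto

lemma evaluates_numterm: "evaluates gn (numterm m) m 0"
  by (induction m) (auto intro: evaluates.intros)

lemma evaluates_numtermD: "evaluates gn (numterm n) m k \<Longrightarrow> m = n \<and> k = 0"
  by (induction n arbitrary: m) (auto elim: evaluates_ZeroE evaluates_PrimeE)

lemma evaluates_App_numtermE:
  assumes "evaluates gn (App c (map numterm ns)) m k"
  obtains r w k' where "k = Suc k'" "shortcut gn r (App c (map numterm ns)) w"
    "evaluates gn w m k'"
  using assms
proof (cases rule: evaluates_AppE)
  case 1: (App ms ks r w k')
  have vals: "ms ! j = ns ! j \<and> ks ! j = 0" if "j < length ns" for j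
    using 1(4) that evaluates_numtermD[of gn "ns ! j" "ms ! j" "ks ! j"] by simp
  have "ms = ns"
    using 1(2) vals by (auto intro: nth_equalityI)
  moreover have "sum_list ks = 0"
    using 1(3) vals by (auto simp: sum_list_sum_nth)
  ultimately show ?thesis
    using 1 by (intro that[of k' r w]) auto
qed

text \<open>Evaluating arguments first changes only the cost: whatever the function symbol does to the
  values, it does to the arguments.\<close>

lemma evaluates_AppI:
  assumes "list_all2 (\<lambda>t m. \<exists>k. evaluates gn t m k) ts ms"
    and "\<exists>k. evaluates gn (App c (map numterm ms)) m k"
  shows "\<exists>k. evaluates gn (App c ts) m k"
proof -
  have len: "length ms = length ts"
    using assms(1) by (auto dest: list_all2_lengthD)
  have "\<forall>j < length ts. \<exists>k. evaluates gn (ts ! j) (ms ! j) k"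
    using assms(1) by (auto simp: list_all2_conv_all_nth)
  then obtain f where "\<forall>j < length ts. evaluates gn (ts ! j) (ms ! j) (f j)"
    by metis
  then have "\<forall>j < length ts. evaluates gn (ts ! j) (ms ! j) (map f [0..<length ts] ! j)"
    by simp
  moreover obtain r w k where "shortcut gn r (App c (map numterm ms)) w" "evaluates gn w m k"
    using assms(2) by (auto elim: evaluates_App_numtermE)
  ultimately show ?thesis
    using evaluates_App[OF len, of "map f [0..<length ts]"] by fastforce
qed

lemma evaluates_shortcut:
  assumes "shortcut gn r (App c (map numterm ns)) w" "evaluates gn w m k"
  shows "\<exists>k. evaluates gn (App c (map numterm ns)) m k"
  using evaluates_App[of ns "map numterm ns" "replicate (length ns) 0"] assms
  by (fastforce simp: evaluates_numterm)

lemma list_all2_numterm: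
  "list_all2 (\<lambda>t m. \<exists>k. evaluates gn t m k) (map numterm ns) ns"
  by (auto simp: list_all2_conv_all_nth intro: evaluates_numterm)

text \<open>Totality of primitive recursion. The contractum of a composition or recursion has unevaluated
  terms as arguments; \<open>evaluates_AppI\<close> reduces these to the numerals which the induction
  hypotheses speak about.\<close>

lemma symbol_evaluates:
  assumes "defines_symbol gn c k" "length ns = k"
  shows "\<exists>m l. evaluates gn (App c (map numterm ns)) m l"
  using assms
proof (induction arbitrary: ns rule: defines_symbol.induct)
  case 1
  then obtain m where "ns = [m]" by (auto simp: length_Suc_conv)
  then show ?case
    using evaluates_shortcut[of gn RuleZ 0 "[m]" Zero 0 0] shortcut.intros(1)[of gn m]
    by (auto intro: evaluates_Zero)
next
  case 2
  then obtain m where "ns = [m]" by (auto simp: length_Suc_conv)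
  then show ?case
    using evaluates_shortcut[of gn RuleS 1 "[m]" "numterm (Suc m)"]
      shortcut.intros(2)[of gn m] evaluates_numterm[of gn "Suc m"]
    by fastforce
next
  case (3 c j k)
  then show ?case
    using evaluates_shortcut[OF shortcut.intros(3) evaluates_numterm] by blast
next
  case (4 c b cs k)
  let ?ns = "map numterm ns"
  have ix: "comp_index gn c b cs k"
    using 4 by (auto simp: comp_index_def)
  have "\<forall>c' \<in> set cs. \<exists>m l. evaluates gn (App c' ?ns) m l"
    using 4 by blast
  then obtain f where f: "\<forall>c' \<in> set cs. \<exists>l. evaluates gn (App c' ?ns) (f c') l"
    by metis
  obtain m where m: "\<exists>l. evaluates gn (App b (map numterm (map f cs))) m l"
    using "4.IH"(1)[of "map f cs"] by auto
  have "list_all2 (\<lambda>t m. \<exists>l. evaluates gn t m l) (map (\<lambda>c'. App c' ?ns) cs) (map f cs)"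
    using f by (auto simp: list_all2_conv_all_nth)
  from evaluates_AppI[OF this m]
  show ?case
    using evaluates_shortcut[OF shortcut.intros(4)[OF ix "4.prems"]] by blast
next
  case (5 c a d k)
  have ix: "rec_index gn c a d k"
    using 5 by (auto simp: rec_index_def)
  obtain ps q where ns: "ns = ps @ [q]" and len: "length ps = k"
    using "5.prems" by (cases ns rule: rev_cases) auto
  have "\<exists>m l. evaluates gn (App c (map numterm (ps @ [q]))) m l"
  proof (induction q)
    case 0
    obtain m l where "evaluates gn (App a (map numterm ps)) m l"
      using "5.IH"(1)[OF len] by blast
    then show ?case
      using evaluates_shortcut[of gn RuleR1 c "ps @ [0]"] shortcut.intros(5)[OF ix len]
      by fastforce
  next
    case (Suc q)
    then obtain m where m: "\<exists>l. evaluates gn (App c (map numterm (ps @ [q]))) m l"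
      by blast
    obtain m' where m': "\<exists>l. evaluates gn (App d (map numterm (m # ps @ [q]))) m' l"
      using "5.IH"(2)[of "m # ps @ [q]"] len by auto
    have "list_all2 (\<lambda>t m. \<exists>l. evaluates gn t m l)
        (App c (map numterm (ps @ [q])) # map numterm (ps @ [q])) (m # ps @ [q])"
      using m list_all2_numterm[of gn "ps @ [q]"] by simp
    from evaluates_AppI[OF this m'] obtain l where
      "evaluates gn (App d (App c (map numterm ps @ [numterm q]) # map numterm ps @ [numterm q])) m' l"
      by auto
    then show ?case
      using evaluates_shortcut[of gn RuleR2 c "ps @ [Suc q]"] shortcut.intros(6)[OF ix len, of q]
      by fastforce
  qed
  then show ?case by (simp add: ns)
qed

lemma evaluates_subterm:
  "subterm_at t p = Some v \<Longrightarrow> evaluates gn t m k \<Longrightarrow> \<exists>m' k'. evaluates gn v m' k'"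
proof (induction t p arbitrary: m k rule: subterm_at.induct)
  case (3 c ts j p)
  then have "j < length ts" "subterm_at (ts ! j) p = Some v"
    by (auto split: if_splits)
  then show ?case
    using "3.IH" "3.prems"(2) by (blast elim: evaluates_AppE)
qed (auto elim: evaluates_PrimeE split: if_splits)

lemma sum_list_update_Suc:
  fixes ks :: "nat list"
  assumes "j < length ks" "ks ! j = Suc l"
  shows "sum_list ks = Suc (sum_list (ks[j := l]))"
  using assms
proof (induction ks arbitrary: j)
  case (Cons k ks)
  then show ?case by (cases j) auto
qed simp

lemma shortcut_redex:
  assumes "shortcut gn r v w"
  shows "\<exists>c ns. v = App c (map numterm ns)"
  using assms
proof cases
  case (1 m)
  then have "v = App 0 (map numterm [m])" by simp
  then show ?thesis by blast
next
  case (2 m)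
  then have "v = App 1 (map numterm [m])" by simp
  then show ?thesis by blast
next
  case (5 c a d k ns)
  then have "v = App c (map numterm (ns @ [0]))" by simp
  then show ?thesis by blast
next
  case (6 c a d k ns m)
  then have "v = App c (map numterm (ns @ [Suc m]))" by simp
  then show ?thesis by blast
qed blast+

text \<open>The step that makes the evaluation order irrelevant. A replaced term has numeral arguments, of
  cost \<open>0\<close>, and only one shortcut applies to it, so its own evaluation must begin with this very
  replacement; above it, costs of arguments are added up.\<close>

lemma evaluates_replace:
  assumes "goedel_numbering gn" "shortcut gn r v w"
  shows "subterm_at t p = Some v \<Longrightarrow> evaluates gn t m k \<Longrightarrow>
    \<exists>k'. k = Suc k' \<and> evaluates gn (replace_at t p w) m k'"
proof (induction t p arbitrary: m k rule: subterm_at.induct)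
  case (1 t)
  obtain c ns where v: "v = App c (map numterm ns)"
    using shortcut_redex[OF assms(2)] by blast
  with 1 have "evaluates gn (App c (map numterm ns)) m k" by simp
  then obtain r' w' k' where "k = Suc k'" "shortcut gn r' v w'" "evaluates gn w' m k'"
    unfolding v by (rule evaluates_App_numtermE)
  then show ?case
    using shortcut_unique[OF assms(1,2)] by auto
next
  case (2 t j p)
  then show ?case
    by (fastforce elim!: evaluates_PrimeE split: if_splits intro: evaluates_Prime)
next
  case (3 c ts j p)
  then have j: "j < length ts" and sub: "subterm_at (ts ! j) p = Some v"
    by (auto split: if_splits)
  from "3.prems"(2) show ?case
  proof (cases rule: evaluates_AppE)
    case 1: (App ms ks r' w' k')
    obtain l where l: "ks ! j = Suc l" "evaluates gn (replace_at (ts ! j) p w) (ms ! j) l"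
      using "3.IH"[OF j sub] 1(4) j by blast
    let ?ts = "ts[j := replace_at (ts ! j) p w]"
    have "\<forall>i < length ?ts. evaluates gn (?ts ! i) (ms ! i) (ks[j := l] ! i)"
      using 1(3,4) l j by (auto simp: nth_list_update)
    then have "evaluates gn (App c ?ts) m (Suc (sum_list (ks[j := l]) + k'))"
      using 1 by (intro evaluates_App) auto
    then show ?thesis
      using 1(1,3) j l(1) sum_list_update_Suc[of j ks l] by simp
  qed
qed auto


section \<open>Occurrences and the counter\<close>

abbreviation fcount :: "trm \<Rightarrow> nat" where
  "fcount t \<equiv> count_list (term_str t) SF"

lemma count_list_numstr [simp]: "count_list (numstr n) SF = 0"
  by (induction n) (auto simp: numstr_def)

lemma count_list_commas: "count_list (commas ss) SF = (\<Sum>s\<leftarrow>ss. count_list s SF)"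
  by (induction ss rule: commas.induct) auto

lemma fcount_App: "fcount (App c ts) = Suc (\<Sum>t\<leftarrow>ts. fcount t)"
  by (simp add: count_list_commas comp_def)

lemma fcount_numterm [simp]: "fcount (numterm n) = 0"
  by (induction n) auto

text \<open>Stated as a sum on both sides because subtraction on the natural numbers truncates.\<close>

lemma fcount_replace:
  "subterm_at t p = Some v \<Longrightarrow> fcount (replace_at t p w) + fcount v = fcount t + fcount w"
proof (induction t p rule: subterm_at.induct)
  case (3 c ts j p)
  then have j: "j < length ts" and
    IH: "fcount (replace_at (ts ! j) p w) + fcount v = fcount (ts ! j) + fcount w"
    by (auto split: if_splits)
  have "(\<Sum>t\<leftarrow>ts[j := u]. fcount t) + fcount (ts ! j) = (\<Sum>t\<leftarrow>ts. fcount t) + fcount u" for u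
    using j
  proof (induction ts arbitrary: j)
    case (Cons t ts)
    then show ?case by (cases j) auto
  qed simp
  from this[of "replace_at (ts ! j) p w"] IH show ?case
    by (simp add: fcount_App del: term_str.simps)
qed (auto split: if_splits)

text \<open>The changes of the counter prescribed by Step 6 are the differences in the number of function
  symbols between the two sides of each shortcut; the replaced term itself has exactly
  one, so the truncated subtraction in \<open>adjust\<close> is exact.\<close>

lemma adjust_correct:
  assumes "shortcut gn r v w" "subterm_at t p = Some v"
  shows "adjust r (fcount t) = fcount (replace_at t p w)"
  using assms(1) fcount_replace[OF assms(2), of w]
  by cases (auto simp: fcount_App comp_def sum_list_triv simp del: term_str.simps(4))

lemma finite_positions: "finite {p. subterm_at t p \<noteq> None}"
proof (induction t)
  case Zero
  have "{p. subterm_at Zero p \<noteq> None} = {[]}"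
    by (auto elim: subterm_at.elims)
  then show ?case by simp
next
  case (Prime t)
  have "{p. subterm_at (Prime t) p \<noteq> None} \<subseteq> insert [] ((#) 0 ` {p. subterm_at t p \<noteq> None})"
    by (auto elim!: subterm_at.elims[of "Prime t"] simp: image_iff split: if_splits)
  then show ?case using Prime finite_subset by blast
next
  case (Var x)
  have "{p. subterm_at (Var x) p \<noteq> None} = {[]}"
    by (auto elim: subterm_at.elims)
  then show ?case by simp
next
  case (App c ts)
  have "{p. subterm_at (App c ts) p \<noteq> None} \<subseteq>
      insert [] (\<Union>j<length ts. (#) j ` {p. subterm_at (ts ! j) p \<noteq> None})"
  proof
    fix p
    assume "p \<in> {p. subterm_at (App c ts) p \<noteq> None}"
    then show "p \<in> insert [] (\<Union>j<length ts. (#) j ` {p. subterm_at (ts ! j) p \<noteq> None})"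
      by (cases p) (auto split: if_splits)
  qed
  moreover have "finite (insert [] (\<Union>j<length ts. (#) j ` {p. subterm_at (ts ! j) p \<noteq> None}))"
    using App by auto
  ultimately show ?case using finite_subset by blast
qed

lemma nn_occurrence_exists: "fcount t \<noteq> 0 \<Longrightarrow> \<exists>p. nn_occurrence t p"
proof (induction t)
  case (Prime t)
  then obtain p where "nn_occurrence t p" by auto
  then have "nn_occurrence (Prime t) (0 # p)" by (simp add: nn_occurrence_def)
  then show ?case by blast
next
  case (App c ts)
  have "nn_occurrence (App c ts) []" by (simp add: nn_occurrence_def)
  then show ?case by blast
qed auto

text \<open>The order that defines the selection is total on paths, so a finite nonempty set of occurrences
  has a greatest element.\<close>

lemma selected_exists:
  assumes "fcount t \<noteq> 0"
  shows "\<exists>p. selected t p"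
proof -
  let ?lex = "lexord {(a, b). a < (b :: nat)}"
  let ?R = "\<lambda>q p. paren_depth t q < paren_depth t p \<or>
    paren_depth t q = paren_depth t p \<and> (q, p) \<in> ?lex"
  let ?P = "{p. nn_occurrence t p}"
  have "finite ?P"
    by (rule finite_subset[OF _ finite_positions[of t]]) (auto simp: nn_occurrence_def)
  moreover have "?P \<noteq> {}"
    using nn_occurrence_exists[OF assms] by blast
  moreover have "transp_on ?P ?R"
  proof -
    have "trans ?lex" by (rule lexord_transI) (auto intro: transI)
    then show ?thesis by (intro transp_onI) (auto dest: transD)
  qed
  moreover have "asymp_on ?P ?R"
  proof -
    have "asym ?lex" by (rule lexord_asym) (auto intro: asymI)
    then show ?thesis by (intro asymp_onI) (auto dest: asymD)
  qed
  moreover have "totalp_on ?P ?R"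
  proof (rule totalp_onI)
    fix p q :: "nat list"
    assume "p \<noteq> q"
    moreover have "\<forall>a b. (a, b) \<in> {(a, b). a < (b :: nat)} \<or> a = b \<or> (b, a) \<in> {(a, b). a < b}"
      by auto
    ultimately have "(p, q) \<in> ?lex \<or> (q, p) \<in> ?lex"
      using lexord_linear[of "{(a, b). a < (b :: nat)}" p q] by blast
    then show "?R p q \<or> ?R q p" by auto
  qed
  ultimately obtain p where "p \<in> ?P" "\<forall>q \<in> ?P. q \<noteq> p \<longrightarrow> ?R q p"
    using Finite_Set.bex_greatest_element[of ?P ?R] by blast
  then show ?thesis unfolding selected_def by blast
qed

lemma subterm_at_append:
  "subterm_at t p = Some v \<Longrightarrow> subterm_at t (p @ q) = subterm_at v q"
  by (induction t p rule: subterm_at.induct) (auto split: if_splits)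

lemma paren_depth_append:
  "subterm_at t p = Some v \<Longrightarrow> paren_depth t (p @ q) = paren_depth t p + paren_depth v q"
  by (induction t p rule: subterm_at.induct) (auto split: if_splits)

lemma selected_args_fcount:
  assumes "selected t p" "subterm_at t p = Some (App c ts)" "j < length ts"
  shows "fcount (ts ! j) = 0"
proof (rule ccontr)
  assume "fcount (ts ! j) \<noteq> 0"
  then obtain q where "nn_occurrence (ts ! j) q"
    using nn_occurrence_exists by blast
  then have "nn_occurrence t (p @ j # q)"
    using assms by (simp add: nn_occurrence_def subterm_at_append[OF assms(2)])
  moreover have "paren_depth t p < paren_depth t (p @ j # q)"
    using paren_depth_append[OF assms(2), of "j # q"] by simp
  ultimately show False
    using assms(1) unfolding selected_def by fastforce
qed

lemma evaluates_fcount_0: "evaluates gn t m k \<Longrightarrow> fcount t = 0 \<Longrightarrow> t = numterm m"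
  by (induction rule: evaluates.induct) auto

text \<open>A subterm of a term with a value has a value, and the derivation of that value supplies a
  shortcut for the term with its arguments replaced by their numerals. Under a selected occurrence
  the arguments already are these numerals.\<close>

lemma selected_shortcut:
  assumes "evaluates gn t m k" "selected t p"
  shows "\<exists>r v w. subterm_at t p = Some v \<and> shortcut gn r v w"
proof -
  obtain c ts where sub: "subterm_at t p = Some (App c ts)"
    using assms(2) by (auto simp: selected_def nn_occurrence_def)
  then obtain m' k' where "evaluates gn (App c ts) m' k'"
    using evaluates_subterm assms(1) by blast
  then show ?thesis
  proof (cases rule: evaluates_AppE)
    case 1: (App ms ks r w l)
    have "ts ! j = numterm (ms ! j)" if "j < length ts" for j
      using 1(4) that evaluates_fcount_0 selected_args_fcount[OF assms(2) sub that] by blast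
    then have "ts = map numterm ms"
      using 1(2) by (auto intro: nth_equalityI)
    then show ?thesis using sub 1(5) by blast
  qed
qed


section \<open>The main loop\<close>

lemma is_proof_Nil [simp]: "is_proof gn []"
  by (simp add: is_proof_def)

lemma is_proof_snoc:
  "is_proof gn (L @ [q]) \<longleftrightarrow> is_proof gn L \<and> (pra_axiom gn q \<or> follows gn (set L) q)"
  unfolding is_proof_def
  by (auto simp: nth_append less_Suc_eq)

text \<open>Induction on the cost. It is stated for any proof \<open>L\<close> whose last line has the evaluable
  right-hand side \<open>t\<close>, and with the counter equal to the number of function symbols in \<open>t\<close>;
  both are invariants of the loop.\<close>

lemma main_loop:
  assumes gn: "goedel_numbering gn"
    and "evaluates gn t m k" "proof_of gn L (Eq s t)"
  shows "\<exists>L'. (step gn i n)\<^sup>*\<^sup>* (Step5 L (fcount t)) (Halted L') \<and> proof_of gn L' (Eq s (numterm m))"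
  using assms(2,3)
proof (induction k arbitrary: t L rule: less_induct)
  case (less k)
  have last: "last L = Eq s t" and L: "is_proof gn L" "L \<noteq> []"
    using less.prems(2) by (auto simp: proof_of_def)
  show ?case
  proof (cases "fcount t = 0")
    case True
    then have "t = numterm m"
      using less.prems(1) evaluates_fcount_0 by blast
    then show ?thesis
      using True step5_halt less.prems(2) by (metis r_into_rtranclp)
  next
    case False
    obtain p where p: "selected t p"
      using selected_exists[OF False] by blast
    obtain r v w where sub: "subterm_at t p = Some v" and sc: "shortcut gn r v w"
      using selected_shortcut[OF less.prems(1) p] by blast
    let ?t = "replace_at t p w"
    let ?L = "L @ [Eq s ?t]"
    obtain k' where k': "k = Suc k'" "evaluates gn ?t m k'"
      using evaluates_replace[OF gn sc sub less.prems(1)] by blast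
    have "Eq s t \<in> set L"
      using last L(2) by (metis last_in_set)
    then have "follows gn (set L) (Eq s ?t)"
      using follows.intros(5) shortcut_form.intros(2)[OF sub sc] by blast
    then have "proof_of gn ?L (Eq s ?t)"
      using L by (simp add: proof_of_def is_proof_snoc)
    then obtain L' where L': "(step gn i n)\<^sup>*\<^sup>* (Step5 ?L (fcount ?t)) (Halted L')"
      "proof_of gn L' (Eq s (numterm m))"
      using less.IH[of k' ?t ?L] k' by auto
    have "step gn i n (Step5 L (fcount t)) (Step6 L (fcount t) p)"
      using step5_loop[OF False last p] .
    moreover have "step gn i n (Step6 L (fcount t) p) (Step5 ?L (fcount ?t))"
      using step6[OF last sub sc] adjust_correct[OF sc sub] by metis
    ultimately show ?thesis
      using L' by (meson converse_rtranclp_into_rtranclp)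
  qed
qed

text \<open>The baseline term is what a shortcut makes of $f_i(i, n)$, whichever of Steps 2 and 3 produced
  it. It therefore inherits a value from $f_i(i, n)$.\<close>

lemma algorithm_from_Step4:
  assumes gn: "goedel_numbering gn"
    and "defines_symbol gn i 2"
    and "shortcut gn r (App i [numterm i, numterm n]) w"
    and "proof_of gn L (Eq (App i [numterm i, numterm n]) w)"
  shows "\<exists>m L'. (step gn i n)\<^sup>*\<^sup>* (Step4 L) (Halted L') \<and>
    proof_of gn L' (Eq (App i [numterm i, numterm n]) (numterm m))"
proof -
  obtain m k where "evaluates gn (App i (map numterm [i, n])) m k"
    using symbol_evaluates[OF assms(2), of "[i, n]"] by auto
  then obtain r' w' k' where "shortcut gn r' (App i (map numterm [i, n])) w'"
    "evaluates gn w' m k'"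
    by (rule evaluates_App_numtermE)
  then have ev: "evaluates gn w m k'"
    using shortcut_unique[OF gn assms(3)] by auto
  have "step gn i n (Step4 L) (Step5 L (fcount w))"
    using assms(4) by (auto simp: proof_of_def intro: step4)
  then show ?thesis
    using main_loop[OF gn ev assms(4), of i n] by (meson converse_rtranclp_into_rtranclp)
qed

text \<open>The shape of the axiom decides the branch, once uniqueness of codes has excluded the others:
  projections halt in Step 1, recursions reach Step 4 through Step 2, compositions through Step 3.
  Zero and successor have arity \<open>1\<close>.\<close>

lemma algorithm_terminates:
  assumes gn: "goedel_numbering gn" and ax: "fun_axiom gn i 2 A"
  shows "\<exists>m L. generates gn i n L \<and> proof_of gn L (Eq (App i [numterm i, numterm n]) (numterm m))"
proof -
  have xs1: "xs 1 = [Var 1]" and xs2: "xs 2 = [Var 1, Var 2]"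
    by (auto simp: xs_def numeral_2_eq_2)
  have def2: "defines_symbol gn i 2"
    using ax by (rule fun_axiom_defines_symbol)
  have A: "pra_axiom gn A"
    using ax by (rule pra_axiom.intros(1))
  have VS: "is_proof gn [A, subst_form \<sigma> A]" for \<sigma>
    using is_proof_snoc[of gn "[A]"] is_proof_snoc[of gn "[]"] A
    by (auto intro: follows.intros(2))
  from ax show ?thesis
  proof cases
    case (3 j)
    then have j: "i = gn (numstr j @ numstr 2)" "j = 1 \<or> j = 2"
      by (auto simp: proj_index_def)
    let ?q = "subst_form (Var(1 := numterm i, 2 := numterm n)) A"
    have "step gn i n Step1 (Halted [A, ?q])"
      using j(2)
    proof
      assume "j = 1"
      then show ?thesis
        using step1_fst[of i gn A n] j ax by (simp add: 3 xs2)
    next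
      assume "j = 2"
      then show ?thesis
        using step1_snd[of i gn A n] j ax by (simp add: 3 xs2)
    qed
    then have "generates gn i n [A, ?q]"
      by (simp add: generates_def r_into_rtranclp)
    moreover have "\<exists>m. ?q = Eq (App i [numterm i, numterm n]) (numterm m)"
      using j(2) by (auto simp: 3 xs2)
    then have "\<exists>m. proof_of gn [A, ?q] (Eq (App i [numterm i, numterm n]) (numterm m))"
      using VS by (auto simp: proof_of_def)
    ultimately show ?thesis by blast
  next
    case (4 b cs)
    let ?q = "subst_form (Var(1 := numterm i, 2 := numterm n)) A"
    let ?w = "App b (map (\<lambda>c'. App c' (map numterm [i, n])) cs)"
    have "i \<noteq> gn (numstr j @ numstr 2)" if "j = 1 \<or> j = 2" for j
    proof
      assume "i = gn (numstr j @ numstr 2)"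
      moreover have "comp_index gn i b cs 2" by fact
      ultimately have "proj_index gn i j 2"
        using that by (auto simp: proj_index_def comp_index_def)
      then show False
        using proj_comp_disjoint[OF gn] 4 by blast
    qed
    then have s1: "step gn i n Step1 Step2"
      by (intro step1_else) auto
    have s2: "step gn i n Step2 Step3"
      using comp_rec_disjoint[OF gn 4(2)] by (intro step2_else) blast
    have s3: "step gn i n Step3 (Step4 [A, ?q])"
      using step3[OF ax, of _ n] 4(1) xs2 by simp
    have q: "?q = Eq (App i [numterm i, numterm n]) ?w"
      by (auto simp: 4 xs2)
    have sc: "shortcut gn (RuleC (length cs)) (App i [numterm i, numterm n]) ?w"
      using shortcut.intros(4)[OF 4(2), of "[i, n]"] by simp
    have "proof_of gn [A, ?q] (Eq (App i [numterm i, numterm n]) ?w)"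
      using VS[of "Var(1 := numterm i, 2 := numterm n)"] q by (simp add: proof_of_def)
    then show ?thesis
      using algorithm_from_Step4[OF gn def2 sc] s1 s2 s3 unfolding generates_def
      by (meson converse_rtranclp_into_rtranclp)
  next
    case (5 a d k)
    then have ix: "rec_index gn i a d 1" and k: "k = 1" by auto
    have "i \<noteq> gn (numstr j @ numstr 2)" for j
    proof
      assume "i = gn (numstr j @ numstr 2)"
      then have "numstr j @ numstr 2 = rec_str a d 1"
        using ix by (auto simp: rec_index_def dest!: gn_eqD[OF gn])
      then show False
        unfolding rec_str_eq_concat proj_str_eq_concat using concat_numstr_neq_SPrime by blast
    qed
    then have s1: "step gn i n Step1 Step2"
      by (intro step1_else) auto
    have A_eq: "A = Conj (Eq (App i [Var 1, Zero]) (App a [Var 1]))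
        (Eq (App i [Var 1, Prime yv]) (App d [App i [Var 1, yv], Var 1, yv]))"
      by (simp add: 5 k xs1[simplified])
    show ?thesis
    proof (cases n)
      case 0
      let ?q = "subst_form (Var(1 := numterm i, 0 := numterm n)) A"
      let ?e = "Eq (App i [numterm i, Zero]) (App a [numterm i])"
      have s2: "step gn i n Step2 (Step4 [A, ?q, ?e])"
        by (rule step2_zero[OF ix ax 0])
      have "\<exists>p. ?q = Conj ?e p"
        by (auto simp: A_eq Conj_def)
      then have "follows gn (set [A, ?q]) ?e"
        by (auto intro: follows.intros(3))
      then have pr: "proof_of gn [A, ?q, ?e] (Eq (App i [numterm i, numterm n]) (App a [numterm i]))"
        using VS is_proof_snoc[of gn "[A, ?q]" ?e] 0 by (simp add: proof_of_def)
      have sc: "shortcut gn RuleR1 (App i [numterm i, numterm n]) (App a [numterm i])"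
        using shortcut.intros(5)[OF ix, of "[i]"] 0 by simp
      show ?thesis
        using algorithm_from_Step4[OF gn def2 sc pr] s1 s2 unfolding generates_def
        by (meson converse_rtranclp_into_rtranclp)
    next
      case (Suc n')
      let ?q = "subst_form (Var(1 := numterm i, 0 := numterm (n - 1))) A"
      let ?w = "App d [App i [numterm i, numterm (n - 1)], numterm i, numterm (n - 1)]"
      let ?e = "Eq (App i [numterm i, Prime (numterm (n - 1))]) ?w"
      have s2: "step gn i n Step2 (Step4 [A, ?q, ?e])"
        by (rule step2_prime[OF ix ax]) (simp add: Suc)
      have "\<exists>p. ?q = Conj p ?e"
        by (auto simp: A_eq Conj_def)
      then have "follows gn (set [A, ?q]) ?e"
        by (auto intro: follows.intros(4))
      then have pr: "proof_of gn [A, ?q, ?e] (Eq (App i [numterm i, numterm n]) ?w)"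
        using VS is_proof_snoc[of gn "[A, ?q]" ?e] Suc by (simp add: proof_of_def)
      have sc: "shortcut gn RuleR2 (App i [numterm i, numterm n]) ?w"
        using shortcut.intros(6)[OF ix, of "[i]" n'] Suc by simp
      show ?thesis
        using algorithm_from_Step4[OF gn def2 sc pr] s1 s2 unfolding generates_def
        by (meson converse_rtranclp_into_rtranclp)
    qed
  qed auto
qed

theorem mainTheorem1:
  fixes gn :: "sym list \<Rightarrow> nat" and i n :: nat and A :: form
  assumes "goedel_numbering gn"
    and "fun_axiom gn i 2 A"
    and "e gn i = gn (form_str A)"
  shows "\<exists>m L. generates gn i n L \<and> (\<forall>L'. generates gn i n L' \<longrightarrow> L' = L) \<and>
           proof_of gn L (Eq (App i [numterm i, numterm n]) (numterm m)) \<and>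
           halts gn i n"
proof -
  obtain m L where run: "(step gn i n)\<^sup>*\<^sup>* Step1 (Halted L)"
    and pr: "proof_of gn L (Eq (App i [numterm i, numterm n]) (numterm m))"
    using algorithm_terminates[OF assms(1,2)] unfolding generates_def by blast
  have det: "right_unique (step gn i n)"
    using step_deterministic[OF assms(1)] by (auto intro: right_uniqueI)
  have final: "\<not> step gn i n (Halted L'') c" for L'' c
    by (auto elim: step.cases)
  have reach: "(step gn i n)\<^sup>*\<^sup>* c (Halted L)" if "(step gn i n)\<^sup>*\<^sup>* Step1 c" for c
    using deterministic_reaches_end[OF det run final that] .
  have stuck: "c = Halted L"
    if "(step gn i n)\<^sup>*\<^sup>* Step1 c" "\<And>c'. \<not> step gn i n c c'" for c
    using reach[OF that(1)] by (cases rule: converse_rtranclpE) (use that(2) in auto)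
  have "L' = L" if "generates gn i n L'" for L'
    using stuck[of "Halted L'"] that final by (simp add: generates_def)
  moreover have "halts gn i n"
    unfolding halts_def
  proof (intro conjI allI impI)
    show "\<nexists>g. g 0 = Step1 \<and> (\<forall>j. step gn i n (g j) (g (Suc j)))"
      using deterministic_no_infinite_run[OF det run final] by blast
    show "\<exists>L. c = Halted L"
      if "(step gn i n)\<^sup>*\<^sup>* Step1 c \<and> (\<nexists>c'. step gn i n c c')" for c
      using stuck[of c] that by blast
  qed
  ultimately show ?thesis
    using run pr unfolding generates_def by blast
qed

end
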